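(* Let $G$ be an amenable, locally compact, separable group acting continuously, by $\mu$-preserving homeomorphisms, on a compact metric space $(X,\upsilon)$ equipped with a Borel probability measure $\mu$, such that the action is uniquely ergodic for $\mu$ and non-sensitive on $\operatorname{supp}\mu$. Then $G$ acts on $X$ equicontinuously.
   Context: Elements of $G$ are identified in notation with the homeomorphisms of $X$ by which they act, the product in $G$ acting as composition. The action is uniquely ergodic for $\mu$ if $\mu$ is the only $G$-invariant Borel probability measure on $X$. A continuous action of $G$ on a compact metric space $(X,\upsilon)$ is called sensitive on $X'\subset X$ if there exists $\beta>0$ such that for every $x\in X'$ and $\delta>0$ there exist $y\in X$ with $\upsilon(x,y)<\delta$ and $h\in G$ with $\upsilon(h(x),h(y))\ge\beta$; otherwise it is called non-sensitive on $X'$. A point $x\in X$ is an equicontinuity point for $G$ if for every $\varepsilon>0$ there exists $\delta>0$ such that $\upsilon(x,y)<\delta$ implies $\upsilon(\Phi(x),\Phi(y))<\varepsilon$ for every $\Phi\in G$; $G$ acts equicontinuously on $X$ if every $x\in X$ is an equicontinuity point for $G$. *)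

theory Defs
  imports "HOL-Probability.Probability" "HOL-Algebra.Group_Action"
begin

locale topological_group = group G for G :: "('g, 'm) monoid_scheme" (structure) +
  fixes T :: "'g topology"
  assumes topspace_eq: "topspace T = carrier G"
    and continuous_mult: "continuous_map (prod_topology T T) T (\<lambda>(g, h). g \<otimes> h)"
    and continuous_inv: "continuous_map T T (\<lambda>g. inv g)"

definition bounded_continuous :: "'g topology \<Rightarrow> ('g \<Rightarrow> real) set" where
  "bounded_continuous T = {f. continuous_map T euclideanreal f \<and> bounded (f ` topspace T)}"

text \<open>
  A left-invariant mean is a normalised positive linear functional that is unchanged when a
  function is replaced by any of its left translates. Elements of \<^term>\<open>bounded_continuous T\<close>
  are total functions with arbitrary values outside the group; linearity and positivity (which
  only inspects values on the group) force the mean to depend only on the values on the group.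
\<close>

definition left_invariant_mean ::
    "('g, 'm) monoid_scheme \<Rightarrow> 'g topology \<Rightarrow> (('g \<Rightarrow> real) \<Rightarrow> real) \<Rightarrow> bool" where
  "left_invariant_mean G T m \<longleftrightarrow>
     (\<forall>f\<in>bounded_continuous T. \<forall>f'\<in>bounded_continuous T. m (\<lambda>g. f g + f' g) = m f + m f') \<and>
     (\<forall>f\<in>bounded_continuous T. \<forall>c. m (\<lambda>g. c * f g) = c * m f) \<and>
     (\<forall>f\<in>bounded_continuous T. (\<forall>g\<in>carrier G. 0 \<le> f g) \<longrightarrow> 0 \<le> m f) \<and>
     m (\<lambda>_. 1) = 1 \<and>
     (\<forall>f\<in>bounded_continuous T. \<forall>h\<in>carrier G. m (\<lambda>g. f (h \<otimes>\<^bsub>G\<^esub> g)) = m f)"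

text \<open>
  Amenability of a topological group, by means of an invariant mean on the bounded continuous
  functions. For a locally compact group, an invariant mean on the space of essentially bounded
  functions with respect to Haar measure restricts to one on the bounded continuous functions.
\<close>

definition amenable :: "('g, 'm) monoid_scheme \<Rightarrow> 'g topology \<Rightarrow> bool" where
  "amenable G T \<longleftrightarrow> (\<exists>m. left_invariant_mean G T m)"

text \<open>
  Throughout, the compact metric space is the universe of a metric type, and a group action is
  a homomorphism into its group of bijections; the product of the group thus acts as composition.
\<close>

definition continuous_action ::
    "('g, 'm) monoid_scheme \<Rightarrow> 'g topology \<Rightarrow> ('g \<Rightarrow> 'x::topological_space \<Rightarrow> 'x) \<Rightarrow> bool" where
  "continuous_action G T \<phi> \<longleftrightarrow>
     group_action G UNIV \<phi> \<and>
     continuous_map (prod_topology T euclidean) euclidean (\<lambda>(g, x). \<phi> g x)"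

definition borel_probability :: "'x::topological_space measure \<Rightarrow> bool" where
  "borel_probability \<mu> \<longleftrightarrow> prob_space \<mu> \<and> sets \<mu> = sets borel"

definition invariant_measure ::
    "('g, 'm) monoid_scheme \<Rightarrow> ('g \<Rightarrow> 'x \<Rightarrow> 'x) \<Rightarrow> 'x measure \<Rightarrow> bool" where
  "invariant_measure G \<phi> \<mu> \<longleftrightarrow> (\<forall>g\<in>carrier G. distr \<mu> \<mu> (\<phi> g) = \<mu>)"

definition uniquely_ergodic ::
    "('g, 'm) monoid_scheme \<Rightarrow> ('g \<Rightarrow> 'x::topological_space \<Rightarrow> 'x) \<Rightarrow> 'x measure \<Rightarrow> bool" where
  "uniquely_ergodic G \<phi> \<mu> \<longleftrightarrow>
     (\<forall>\<nu>. borel_probability \<nu> \<and> invariant_measure G \<phi> \<nu> \<longleftrightarrow> \<nu> = \<mu>)"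

definition measure_support :: "'x::topological_space measure \<Rightarrow> 'x set" where
  "measure_support \<mu> = {x. \<forall>U. open U \<and> x \<in> U \<longrightarrow> 0 < emeasure \<mu> U}"

definition sensitive_on ::
    "('g, 'm) monoid_scheme \<Rightarrow> ('g \<Rightarrow> 'x::metric_space \<Rightarrow> 'x) \<Rightarrow> 'x set \<Rightarrow> bool" where
  "sensitive_on G \<phi> X' \<longleftrightarrow>
     (\<exists>\<beta>>0. \<forall>x\<in>X'. \<forall>\<delta>>0. \<exists>y. dist x y < \<delta> \<and> (\<exists>h\<in>carrier G. dist (\<phi> h x) (\<phi> h y) \<ge> \<beta>))"

definition equicontinuity_point ::
    "('g, 'm) monoid_scheme \<Rightarrow> ('g \<Rightarrow> 'x::metric_space \<Rightarrow> 'x) \<Rightarrow> 'x \<Rightarrow> bool" where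
  "equicontinuity_point G \<phi> x \<longleftrightarrow>
     (\<forall>\<epsilon>>0. \<exists>\<delta>>0. \<forall>y. dist x y < \<delta> \<longrightarrow> (\<forall>g\<in>carrier G. dist (\<phi> g x) (\<phi> g y) < \<epsilon>))"

definition acts_equicontinuously ::
    "('g, 'm) monoid_scheme \<Rightarrow> ('g \<Rightarrow> 'x::metric_space \<Rightarrow> 'x) \<Rightarrow> bool" where
  "acts_equicontinuously G \<phi> \<longleftrightarrow> (\<forall>x. equicontinuity_point G \<phi> x)"

end

theory Submission
  imports Defs
begin

text \<open>
  For each \<open>\<beta>\<close>, non-sensitivity gives a ball \<open>U\<close> centred in the support of \<open>\<mu>\<close> whose points
  stay \<open>\<beta>\<close>-close to the centre under the group. Every orbit meets \<open>U\<close>, and an element carrying a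
  neighbourhood of a given point into \<open>U\<close> transports the estimate to that point. If the orbit of
  \<open>z\<close> missed \<open>U\<close>, then averaging \<open>f (g z)\<close> over \<open>g\<close> with an invariant mean would give an invariant
  positive functional \<open>L\<close> vanishing on functions supported in \<open>U\<close>, hence an invariant Borel
  probability measure that is null on \<open>U\<close>, contradicting unique ergodicity. Instead of the
  Riesz representation theorem, only the existence of a suitable measure is needed; it comes from
  the outer measure which assigns to \<open>A\<close> the infimum of \<open>\<Sum>n. L (f n)\<close> over the sequences of
  nonnegative continuous functions with \<open>(\<Sum>n. f n) \<ge> 1\<close> on \<open>A\<close>.
\<close>

section \<open>Normalised positive functionals on the continuous functions of a compact metric
  space\<close>

locale positive_functional =
  fixes L :: "('x::metric_space \<Rightarrow> real) \<Rightarrow> real"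
  assumes compact_space: "compact (UNIV :: 'x set)"
    and L_add: "continuous_on UNIV f \<Longrightarrow> continuous_on UNIV g \<Longrightarrow> L (\<lambda>x. f x + g x) = L f + L g"
    and L_scale: "continuous_on UNIV f \<Longrightarrow> L (\<lambda>x. c * f x) = c * L f"
    and L_nonneg: "continuous_on UNIV f \<Longrightarrow> (\<And>x. 0 \<le> f x) \<Longrightarrow> 0 \<le> L f"
    and L_one: "L (\<lambda>_. 1) = 1"
begin

lemma L_const: "L (\<lambda>_. c) = c"
  using L_scale[of "\<lambda>_. 1" c] by (simp add: L_one)

lemma L_diff:
  assumes "continuous_on UNIV f" "continuous_on UNIV g"
  shows "L (\<lambda>x. f x - g x) = L f - L g"
proof -
  have "L (\<lambda>x. f x + (- 1) * g x) = L f + L (\<lambda>x. (- 1) * g x)"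
    by (intro L_add continuous_intros assms)
  then show ?thesis
    using L_scale[OF assms(2), of "- 1"] by simp
qed

lemma L_mono:
  assumes "continuous_on UNIV f" "continuous_on UNIV g" "\<And>x. f x \<le> g x"
  shows "L f \<le> L g"
proof -
  have "0 \<le> L (\<lambda>x. g x - f x)"
    using assms by (intro L_nonneg continuous_intros) auto
  then show ?thesis
    by (simp add: L_diff assms)
qed

lemma L_sum:
  assumes "\<And>i. continuous_on UNIV (F i)"
  shows "L (\<lambda>x. \<Sum>i<n. F i x) = (\<Sum>i<(n::nat). L (F i))"
proof (induction n)
  case 0
  show ?case by (simp add: L_const)
next
  case (Suc n)
  then show ?case
    by (simp add: L_add assms continuous_on_sum)
qed

section \<open>The outer measure of a functional, from countable covers by functions\<close>

definition covers :: "'x set \<Rightarrow> (nat \<Rightarrow> 'x \<Rightarrow> real) set" where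
  "covers A = {F. (\<forall>n. continuous_on UNIV (F n) \<and> (\<forall>x. 0 \<le> F n x)) \<and>
     (\<forall>x\<in>A. 1 \<le> (\<Sum>n. ennreal (F n x)))}"

definition outer :: "'x set \<Rightarrow> ennreal" where
  "outer A = (INF F\<in>covers A. \<Sum>n. ennreal (L (F n)))"

lemma outer_le: "F \<in> covers A \<Longrightarrow> outer A \<le> (\<Sum>n. ennreal (L (F n)))"
  unfolding outer_def by (rule INF_lower)

text \<open>A sum of nonnegative extended reals does not depend on the order of its terms, so a
  doubly indexed cover, enumerated through \<open>prod_decode\<close>, is an ordinary one of the
  same cost. Both subadditivity and the splitting by a closed set produce such double
  families.\<close>

lemma outer_le_double:
  fixes F :: "nat \<Rightarrow> nat \<Rightarrow> 'x \<Rightarrow> real"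
  assumes "\<And>i n. continuous_on UNIV (F i n)" "\<And>i n x. 0 \<le> F i n x"
    and "\<And>x. x \<in> A \<Longrightarrow> 1 \<le> (\<Sum>i. \<Sum>n. ennreal (F i n x))"
  shows "outer A \<le> (\<Sum>i. \<Sum>n. ennreal (L (F i n)))"
proof -
  define H where "H k = (case prod_decode k of (i, n) \<Rightarrow> F i n)" for k
  have "(\<Sum>k. ennreal (H k x)) = (\<Sum>i. \<Sum>n. ennreal (F i n x))" for x
    using suminf_ennreal_2dimen[where f = "\<lambda>(i, n). ennreal (F i n x)"
        and g = "\<lambda>i. \<Sum>n. ennreal (F i n x)"]
    by (simp add: H_def case_prod_beta)
  then have "H \<in> covers A"
    using assms by (auto simp: covers_def H_def split: prod.split)
  moreover have "(\<Sum>k. ennreal (L (H k))) = (\<Sum>i. \<Sum>n. ennreal (L (F i n)))"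
    using suminf_ennreal_2dimen[where f = "\<lambda>(i, n). ennreal (L (F i n))"
        and g = "\<lambda>i. \<Sum>n. ennreal (L (F i n))"]
    by (simp add: H_def case_prod_beta)
  ultimately show ?thesis
    using outer_le by metis
qed

lemma outer_mono: "A \<subseteq> B \<Longrightarrow> outer A \<le> outer B"
  unfolding outer_def by (intro INF_superset_mono) (auto simp: covers_def)

lemma outer_empty: "outer {} = 0"
proof -
  have "(\<lambda>_ _. 0) \<in> covers {}"
    by (simp add: covers_def)
  from outer_le[OF this] show ?thesis
    by (simp add: L_const)
qed

lemma outer_le_1: "outer A \<le> 1"
proof -
  \<comment> \<open>The constant function 1 is a cover by itself; zeros pad it to a
    sequence.\<close>
  define F :: "nat \<Rightarrow> 'x \<Rightarrow> real" where "F n = (if n = 0 then (\<lambda>_. 1) else (\<lambda>_. 0))" for n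
  have "(\<Sum>n. ennreal (F n x)) = (\<Sum>n\<in>{0}. ennreal (F n x))" for x
    by (rule suminf_finite) (auto simp: F_def)
  then have "F \<in> covers A"
    by (auto simp: covers_def F_def)
  moreover have "(\<Sum>n. ennreal (L (F n))) = (\<Sum>n\<in>{0}. ennreal (L (F n)))"
    by (rule suminf_finite) (auto simp: F_def L_const)
  ultimately show ?thesis
    using outer_le[of F A] by (simp add: F_def L_const)
qed

text \<open>A Dini argument gives the lower bound: the partial sums of a cover of the space
  increase, so by compactness a single one exceeds \<open>1 - e\<close> everywhere, and monotonicity
  of \<open>L\<close> bounds its cost from below.\<close>

lemma outer_UNIV: "outer UNIV = 1"
proof (rule antisym[OF outer_le_1])
  show "1 \<le> outer UNIV"
    unfolding outer_def
  proof (rule INF_greatest)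
    fix F :: "nat \<Rightarrow> 'x \<Rightarrow> real" assume "F \<in> covers UNIV"
    then have cont: "\<And>n. continuous_on UNIV (F n)" and pos: "\<And>n x. 0 \<le> F n x"
      and ge: "\<And>x. 1 \<le> (\<Sum>n. ennreal (F n x))"
      by (auto simp: covers_def)
    define S where "S N x = (\<Sum>n<N. F n x)" for N x
    have S_cont: "continuous_on UNIV (S N)" for N
      unfolding S_def by (intro continuous_intros cont)
    have S_mono: "S M x \<le> S N x" if "M \<le> N" for M N x
      unfolding S_def using that by (intro sum_mono2) (auto simp: pos)
    show "1 \<le> (\<Sum>n. ennreal (L (F n)))"
    proof (rule ennreal_le_epsilon)
      fix e :: real assume "0 < e"
      define W where "W N = {x. 1 - e < S N x}" for N
      have W_open: "open (W N)" for N
        unfolding W_def by (intro open_Collect_less continuous_intros S_cont)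
      have W_cover: "\<exists>N. x \<in> W N" for x
      proof -
        \<comment> \<open>For \<open>e > 1\<close> the left side is truncated to 0. Since
          \<open>ennreal\<close> is monotone on all reals, the return to real numbers below needs no
          case distinction on the sign.\<close>
        have "ennreal (1 - e) < 1"
          using \<open>0 < e\<close> by (simp add: ennreal_less_one_iff)
        also have "\<dots> \<le> (SUP N. \<Sum>n<N. ennreal (F n x))"
          using ge by (simp add: suminf_eq_SUP)
        finally obtain N where "ennreal (1 - e) < (\<Sum>n<N. ennreal (F n x))"
          by (auto simp: less_SUP_iff)
        then have "ennreal (1 - e) < ennreal (S N x)"
          by (simp add: S_def pos)
        then have "1 - e < S N x"
          by (rule contrapos_pp) (simp add: not_less ennreal_leI)
        then show ?thesis
          by (auto simp: W_def)
      qed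
      have W_UN: "UNIV \<subseteq> (\<Union>N\<in>UNIV. W N)"
        using W_cover by auto
      obtain I where I: "finite I" "UNIV \<subseteq> (\<Union>N\<in>I. W N)"
        by (rule compactE_image[of UNIV UNIV W, OF compact_space W_open W_UN])
      \<comment> \<open>The sets \<open>W N\<close> increase, so the largest index of the finite
        subcover serves every point; inserting 0 makes the maximum meaningful without first showing
        that \<open>I\<close> is nonempty.\<close>
      define N where "N = Max (insert 0 I)"
      have "1 - e \<le> S N x" for x
      proof -
        obtain M where M: "M \<in> I" "x \<in> W M"
          using I(2) by blast
        then have "M \<le> N"
          unfolding N_def using I(1) by (intro Max_ge) auto
        then have "S M x \<le> S N x"
          by (rule S_mono)
        then show ?thesis
          using M(2) by (simp add: W_def)
      qed
      then have "L (\<lambda>_. 1 - e) \<le> L (S N)"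
        by (intro L_mono S_cont continuous_on_const)
      moreover have "L (S N) = (\<Sum>n<N. L (F n))"
        unfolding S_def[abs_def] by (rule L_sum[OF cont])
      ultimately have "1 \<le> (\<Sum>n<N. L (F n)) + e"
        by (simp add: L_const)
      then have "ennreal 1 \<le> ennreal ((\<Sum>n<N. L (F n)) + e)"
        by (rule ennreal_leI)
      also have "\<dots> = (\<Sum>n<N. ennreal (L (F n))) + ennreal e"
        using \<open>0 < e\<close> L_nonneg[OF cont pos] by (simp add: sum_nonneg)
      also have "\<dots> \<le> (\<Sum>n. ennreal (L (F n))) + ennreal e"
        by (intro add_right_mono sum_le_suminf) auto
      finally show "1 \<le> (\<Sum>n. ennreal (L (F n))) + ennreal e"
        by simp
    qed
  qed
qed

text \<open>Choose for each \<open>A i\<close> a cover that is optimal up to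
  \<open>e / 2 ^ Suc i\<close>. Together they cover the union, and the errors add up to
  \<open>e\<close>.\<close>

lemma outer_UN_le: "outer (\<Union>i. A i) \<le> (\<Sum>i. outer (A (i::nat)))"
proof (rule ennreal_le_epsilon)
  fix e :: real assume "0 < e"
  have "\<exists>F\<in>covers (A i). (\<Sum>n. ennreal (L (F n))) < outer (A i) + ennreal (e * (1/2) ^ Suc i)" for i
  proof -
    \<comment> \<open>Finiteness makes the next inequality strict: adding a positive number to
      infinity would not increase it.\<close>
    have "outer (A i) \<noteq> \<infinity>"
      using outer_le_1[of "A i"] by (auto simp: top_unique)
    moreover have "0 < ennreal (e * (1/2) ^ Suc i)"
      using \<open>0 < e\<close> by simp
    ultimately have "outer (A i) < outer (A i) + ennreal (e * (1/2) ^ Suc i)"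
      by (simp add: ennreal_add_left_cancel_less less_top)
    then show ?thesis
      by (subst (asm) (1) outer_def) (simp add: INF_less_iff)
  qed
  then obtain F where F: "\<And>i. F i \<in> covers (A i)"
    and less: "\<And>i. (\<Sum>n. ennreal (L (F i n))) < outer (A i) + ennreal (e * (1/2) ^ Suc i)"
    by metis
  have "outer (\<Union>i. A i) \<le> (\<Sum>i. \<Sum>n. ennreal (L (F i n)))"
  proof (rule outer_le_double)
    fix x assume "x \<in> (\<Union>i. A i)"
    then obtain i where "x \<in> A i" by auto
    then have "1 \<le> (\<Sum>n. ennreal (F i n x))"
      using F[of i] by (auto simp: covers_def)
    also have "\<dots> \<le> (\<Sum>i. \<Sum>n. ennreal (F i n x))"
      using sum_le_suminf[of "\<lambda>i. \<Sum>n. ennreal (F i n x)" "{i}"] by simp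
    finally show "1 \<le> (\<Sum>i. \<Sum>n. ennreal (F i n x))" .
  qed (use F in \<open>auto simp: covers_def\<close>)
  also have "\<dots> \<le> (\<Sum>i. outer (A i) + ennreal (e * (1/2) ^ Suc i))"
    using less by (intro suminf_le) (auto intro: less_imp_le)
  also have "\<dots> = (\<Sum>i. outer (A i)) + (\<Sum>i. ennreal (e * (1/2) ^ Suc i))"
    by (rule suminf_add[symmetric]) auto
  also have "(\<Sum>i. ennreal (e * (1/2) ^ Suc i)) = ennreal e"
    using \<open>0 < e\<close> sums_mult[OF power_half_series, of e] by (intro suminf_ennreal_eq) auto
  finally show "outer (\<Union>i. A i) \<le> (\<Sum>i. outer (A i)) + ennreal e" .
qed

section \<open>Caratheodory measurability of Borel sets\<close>

lemma outer_measure_space_outer: "outer_measure_space UNIV outer"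
  unfolding outer_measure_space_def positive_def increasing_def countably_subadditive_def
  by (intro conjI ballI impI allI outer_empty outer_mono outer_UN_le)

text \<open>
  Multiplying a cover by the functions \<open>min 1 (k * infdist x C)\<close> splits off its part away from
  \<open>C\<close>; these increase to the indicator of the complement of \<open>C\<close>, so their increments cover it.
\<close>

lemma outer_split_closed:
  assumes "closed C" "C \<noteq> {}"
  shows "outer (A \<inter> C) + outer (A - C) \<le> outer A"
  unfolding outer_def[of A]
proof (rule INF_greatest)
  fix F :: "nat \<Rightarrow> 'x \<Rightarrow> real" assume F: "F \<in> covers A"
  then have cont: "\<And>n. continuous_on UNIV (F n)" and pos: "\<And>n x. 0 \<le> F n x"
    and ge: "\<And>x. x \<in> A \<Longrightarrow> 1 \<le> (\<Sum>n. ennreal (F n x))"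
    by (auto simp: covers_def)
  define h where "h k x = min 1 (real k * infdist x C)" for k x
  have h_cont: "continuous_on UNIV (h k)" for k
    unfolding h_def by (intro continuous_intros)
  have h_range: "0 \<le> h k x" "h k x \<le> 1" for k x
    by (auto simp: h_def infdist_nonneg)
  have h_mono: "h k x \<le> h l x" if "k \<le> l" for k l x
    using mult_right_mono[of "real k" "real l" "infdist x C"] that
    by (auto simp: h_def infdist_nonneg)
  have h_on: "h k x = 0" if "x \<in> C" for k x
    using that by (simp add: h_def)
  have h_0: "h 0 x = 0" for x
    by (simp add: h_def)
  have h_lim: "(\<lambda>k. h k x) \<longlonglongrightarrow> 1" if "x \<notin> C" for x
  proof -
    \<comment> \<open>Nonemptiness of \<open>C\<close> matters here as well as closedness, because
      \<open>infdist x {}\<close> is 0 by convention.\<close>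
    have "0 < infdist x C"
      using assms that infdist_nonneg[of x C] in_closed_iff_infdist_zero[of C x] by force
    then obtain k where k: "1 < real k * infdist x C"
      using reals_Archimedean3 by blast
    have "h l x = 1" if "k \<le> l" for l
      using h_mono[OF that, of x] h_range[of l x] k by (simp add: h_def)
    then show ?thesis
      by (intro tendsto_eventually eventually_sequentiallyI[of k])
  qed
  have Fh_cont: "continuous_on UNIV (\<lambda>x. F n x * h k x)" for n k
    by (intro continuous_intros cont h_cont)
  define p where "p k n = ennreal (L (\<lambda>x. F n x * h k x))" for k n
  have p_mono: "incseq (\<lambda>k. p k n)" for n
    unfolding p_def incseq_def
    by (intro allI impI ennreal_leI L_mono Fh_cont mult_left_mono h_mono pos)
  \<comment> \<open>Each \<open>F n\<close> is the sum of \<open>F n * h k\<close> and a remainder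
    that equals \<open>F n\<close> on \<open>C\<close>. The remainders therefore cover
    \<open>A \<inter> C\<close>, and additivity of \<open>L\<close> gives the bound for every
    \<open>k\<close>.\<close>
  have bound: "(\<Sum>n. p k n) + outer (A \<inter> C) \<le> (\<Sum>n. ennreal (L (F n)))" for k
  proof -
    have G_cont: "continuous_on UNIV (\<lambda>x. F n x - F n x * h k x)" for n
      by (intro continuous_intros cont h_cont)
    have G_pos: "0 \<le> F n x - F n x * h k x" for n x
      using mult_left_mono[OF h_range(2) pos, of n x k x] by simp
    have "(\<lambda>n x. F n x - F n x * h k x) \<in> covers (A \<inter> C)"
      using ge G_cont G_pos by (auto simp: covers_def h_on)
    have split: "p k n + ennreal (L (\<lambda>x. F n x - F n x * h k x)) = ennreal (L (F n))" for n
    proof -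
      have "0 \<le> L (\<lambda>x. F n x * h k x)"
        by (intro L_nonneg Fh_cont mult_nonneg_nonneg pos h_range)
      moreover have "0 \<le> L (\<lambda>x. F n x - F n x * h k x)"
        by (intro L_nonneg G_cont G_pos)
      ultimately show ?thesis
        by (simp add: p_def L_diff[OF cont Fh_cont] flip: ennreal_plus)
    qed
    from outer_le[OF \<open>_ \<in> covers (A \<inter> C)\<close>]
    have "(\<Sum>n. p k n) + outer (A \<inter> C)
        \<le> (\<Sum>n. p k n) + (\<Sum>n. ennreal (L (\<lambda>x. F n x - F n x * h k x)))"
      by (rule add_left_mono)
    also have "\<dots> = (\<Sum>n. p k n + ennreal (L (\<lambda>x. F n x - F n x * h k x)))"
      by (rule suminf_add) auto
    also have "\<dots> = (\<Sum>n. ennreal (L (F n)))"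
      by (simp only: split)
    finally show ?thesis .
  qed
  define D where "D n k x = F n x * h (Suc k) x - F n x * h k x" for n k x
  have D_cont: "continuous_on UNIV (D n k)" for n k
    unfolding D_def by (intro continuous_intros cont h_cont)
  have D_pos: "0 \<le> D n k x" for n k x
    using mult_left_mono[OF h_mono pos, of k "Suc k" n x x] by (simp add: D_def)
  \<comment> \<open>The sum telescopes: as \<open>h 0\<close> vanishes, the first \<open>K\<close>
    increments add up to \<open>F n * h K\<close>, whose cost is \<open>p K n\<close>.\<close>
  have increments: "(\<Sum>k. ennreal (L (D n k))) = (SUP k. p k n)" for n
  proof -
    have "(\<Sum>k<K. ennreal (L (D n k))) = p K n" for K
    proof -
      have "(\<lambda>x. \<Sum>k<K. D n k x) = (\<lambda>x. F n x * h K x)"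
        by (subst D_def, subst sum_lessThan_telescope) (simp add: h_0)
      then show ?thesis
        by (simp add: p_def L_nonneg D_cont D_pos flip: L_sum)
    qed
    then show ?thesis
      by (simp add: suminf_eq_SUP)
  qed
  have "outer (A - C) \<le> (\<Sum>n. \<Sum>k. ennreal (L (D n k)))"
  proof (rule outer_le_double[OF D_cont D_pos])
    fix x assume x: "x \<in> A - C"
    have "(\<Sum>k. ennreal (D n k x)) = ennreal (F n x)" for n
    proof (rule suminf_ennreal_eq[OF D_pos])
      have "(\<lambda>k. F n x * h k x) \<longlonglongrightarrow> F n x * 1"
        using x by (intro tendsto_intros h_lim) auto
      from telescope_sums[OF this] show "(\<lambda>k. D n k x) sums F n x"
        by (simp add: D_def h_0)
    qed
    then show "1 \<le> (\<Sum>n. \<Sum>k. ennreal (D n k x))"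
      using ge x by simp
  qed
  also have "\<dots> = (\<Sum>n. SUP k. p k n)"
    by (simp only: increments)
  \<comment> \<open>Monotone convergence for series moves the supremum outside, where
    \<open>bound\<close> applies for each fixed \<open>k\<close>.\<close>
  also have "(\<Sum>n. SUP k. p k n) = (SUP k. \<Sum>n. p k n)"
    by (rule ennreal_suminf_SUP_eq[OF p_mono])
  finally have "outer (A - C) + outer (A \<inter> C) \<le> (SUP k. \<Sum>n. p k n) + outer (A \<inter> C)"
    by (rule add_right_mono)
  also have "\<dots> = (SUP k. (\<Sum>n. p k n) + outer (A \<inter> C))"
    by (simp add: ennreal_SUP_add_left)
  also have "\<dots> \<le> (\<Sum>n. ennreal (L (F n)))"
    by (intro SUP_least bound)
  finally show "outer (A \<inter> C) + outer (A - C) \<le> (\<Sum>n. ennreal (L (F n)))"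
    by (simp add: add.commute)
qed

text \<open>By Caratheodory the sets that split every set additively form a sigma-algebra on which
  \<open>outer\<close> is a measure. It contains the closed sets, hence all Borel sets.\<close>

lemma measure_space_outer: "measure_space UNIV (sets borel) outer"
proof -
  let ?S = "lambda_system UNIV UNIV outer"
  interpret P: sigma_algebra "UNIV :: 'x set" UNIV
    using sigma_algebra_Pow[of UNIV] by simp
  have ms: "measure_space UNIV ?S outer"
    by (rule P.caratheodory_lemma[OF outer_measure_space_outer])
  then interpret S: sigma_algebra UNIV ?S
    by (simp add: measure_space_def)
  have "C \<in> ?S" if "closed C" for C
  \<comment> \<open>The splitting lemma excludes the empty set, which lies in every sigma-algebra.
    For the other closed sets, the inequality still to be shown is finite subadditivity.\<close>
  proof (cases "C = {}")
    case False
    have "outer A \<le> outer (A \<inter> C) + outer (A - C)" for A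
    proof -
      have "countably_subadditive UNIV outer" "positive UNIV outer"
        using outer_measure_space_outer by (auto simp: outer_measure_space_def)
      then have "subadditive UNIV outer"
        by (rule P.countably_subadditive_subadditive[rotated])
      then have "outer ((A \<inter> C) \<union> (A - C)) \<le> outer (A \<inter> C) + outer (A - C)"
        by (rule subadditiveD) auto
      moreover have "(A \<inter> C) \<union> (A - C) = A" by blast
      ultimately show ?thesis by simp
    qed
    then show ?thesis
      using outer_split_closed[OF that False] by (auto simp: P.lambda_system_eq intro: antisym)
  qed simp
  then have "sigma_sets UNIV (Collect closed) \<subseteq> ?S"
    by (intro S.sigma_sets_subset) auto
  then have "sets borel \<subseteq> ?S"
    by (simp add: borel_eq_closed)
  moreover have "countably_additive ?S outer"
    using ms by (simp add: measure_space_def)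
  ultimately have "countably_additive (sets borel) outer"
    unfolding countably_additive_def by blast
  then show ?thesis
    using sets.sigma_algebra_axioms[of "borel :: 'x measure"]
    by (simp add: measure_space_def positive_def outer_empty)
qed

section \<open>The induced Borel probability measure, its null sets and its invariance\<close>

definition daniell_measure :: "'x measure" where
  "daniell_measure = measure_of UNIV (sets borel) outer"

lemma sets_daniell_measure: "sets daniell_measure = sets borel"
  using sets.sigma_sets_eq[of "borel :: 'x measure"]
  by (simp add: daniell_measure_def)

text \<open>\<open>measure_of\<close> keeps the prescribed values only if they form a measure and
  yields 0 otherwise, so \<open>measure_space_outer\<close> is the essential input.\<close>

lemma emeasure_daniell_measure:
  "A \<in> sets borel \<Longrightarrow> emeasure daniell_measure A = outer A"
  using measure_space_outer unfolding daniell_measure_def measure_space_def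
  by (elim conjE) (rule emeasure_measure_of_sigma)

lemma borel_probability_daniell_measure: "borel_probability daniell_measure"
proof -
  have "space daniell_measure = UNIV"
    using sets_eq_imp_space_eq[OF sets_daniell_measure] by simp
  then have "prob_space daniell_measure"
    by (intro prob_spaceI) (simp add: emeasure_daniell_measure outer_UNIV)
  then show ?thesis
    by (simp add: borel_probability_def sets_daniell_measure)
qed

text \<open>Repeating \<open>f\<close> infinitely often covers the set where it is positive, since
  the sum there is infinite, and the total cost is a sum of zeros.\<close>

lemma daniell_measure_pos_set_eq_0:
  assumes "continuous_on UNIV f" "\<And>x. 0 \<le> f x" "L f = 0"
  shows "emeasure daniell_measure {x. 0 < f x} = 0"
proof -
  have "(\<Sum>n::nat. ennreal (f x)) = \<infinity>" if "0 < f x" for x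
    using that by (simp add: suminf_eq_SUP ennreal_SUP_of_nat_eq_top flip: SUP_mult_right_ennreal)
  then have "(\<lambda>_. f) \<in> covers {x. 0 < f x}"
    using assms by (auto simp: covers_def)
  from outer_le[OF this] have "outer {x. 0 < f x} = 0"
    by (simp add: assms)
  moreover have "open {x. 0 < f x}"
    by (intro open_Collect_less continuous_intros assms)
  ultimately show ?thesis
    by (simp add: emeasure_daniell_measure)
qed

text \<open>Composing a cover of \<open>A\<close> with \<open>\<psi>\<close> gives a cover of the
  preimage, at the same cost because \<open>L\<close> is invariant.\<close>

lemma outer_vimage_le:
  assumes "continuous_on UNIV \<psi>" "\<And>f. continuous_on UNIV f \<Longrightarrow> L (\<lambda>x. f (\<psi> x)) = L f"
  shows "outer (\<psi> -` A) \<le> outer A"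
  unfolding outer_def[of A]
proof (rule INF_greatest)
  fix F :: "nat \<Rightarrow> 'x \<Rightarrow> real" assume F: "F \<in> covers A"
  then have cont: "\<And>n. continuous_on UNIV (F n)"
    by (simp add: covers_def)
  have "continuous_on UNIV (\<lambda>x. F n (\<psi> x))" for n
    by (rule continuous_on_compose2[OF cont assms(1)]) simp
  then have "(\<lambda>n x. F n (\<psi> x)) \<in> covers (\<psi> -` A)"
    using F by (simp add: covers_def)
  from outer_le[OF this] show "outer (\<psi> -` A) \<le> (\<Sum>n. ennreal (L (F n)))"
    by (simp add: assms(2) cont)
qed

lemma distr_daniell_measure:
  assumes "continuous_on UNIV \<psi>" "\<And>f. continuous_on UNIV f \<Longrightarrow> L (\<lambda>x. f (\<psi> x)) = L f"
    and "continuous_on UNIV \<psi>'" "\<And>f. continuous_on UNIV f \<Longrightarrow> L (\<lambda>x. f (\<psi>' x)) = L f"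
    and inverse: "\<And>x. \<psi> (\<psi>' x) = x"
  shows "distr daniell_measure daniell_measure \<psi> = daniell_measure"
proof (rule measure_eqI)
  fix A assume "A \<in> sets (distr daniell_measure daniell_measure \<psi>)"
  then have A: "A \<in> sets borel"
    by (simp add: sets_daniell_measure)
  have meas: "\<psi> \<in> borel_measurable borel"
    by (rule borel_measurable_continuous_onI) fact
  \<comment> \<open>Taking the preimage under \<open>\<psi>'\<close> recovers \<open>A\<close>, so
    applying \<open>outer_vimage_le\<close> to \<open>\<psi>'\<close> supplies the reverse
    inequality.\<close>
  have "\<psi>' -` \<psi> -` A = A"
    using inverse by auto
  then have "outer (\<psi> -` A) = outer A"
    using outer_vimage_le[OF assms(1,2), of A] outer_vimage_le[OF assms(3,4), of "\<psi> -` A"]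
    by (simp add: antisym)
  moreover have "\<psi> -` A \<in> sets borel"
    using measurable_sets[OF meas A] by simp
  moreover have "\<psi> \<in> daniell_measure \<rightarrow>\<^sub>M daniell_measure"
    unfolding measurable_cong_sets[OF sets_daniell_measure sets_daniell_measure] by (rule meas)
  moreover have "space daniell_measure = UNIV"
    using sets_eq_imp_space_eq[OF sets_daniell_measure] by simp
  ultimately show "emeasure (distr daniell_measure daniell_measure \<psi>) A
      = emeasure daniell_measure A"
    using A by (simp add: emeasure_distr sets_daniell_measure emeasure_daniell_measure)
qed (rule sets_distr)

end

section \<open>Invariant means on a topological group\<close>

context topological_group
begin

lemma bounded_continuous_cong:
  assumes "f \<in> bounded_continuous T" "\<And>g. g \<in> carrier G \<Longrightarrow> f g = f' g"
  shows "f' \<in> bounded_continuous T"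
proof -
  have eq: "f g = f' g" if "g \<in> topspace T" for g
    using that unfolding topspace_eq by (rule assms(2))
  have f: "continuous_map T euclideanreal f" "bounded (f ` topspace T)"
    using assms(1) by (simp_all add: bounded_continuous_def)
  have "continuous_map T euclideanreal f'"
    by (rule continuous_map_eq[OF f(1) eq])
  moreover have "f ` topspace T = f' ` topspace T"
    by (rule image_cong[OF refl eq])
  ultimately show ?thesis
    using f(2) by (simp add: bounded_continuous_def)
qed

lemma mean_add:
  assumes "left_invariant_mean G T m" "f \<in> bounded_continuous T" "f' \<in> bounded_continuous T"
  shows "m (\<lambda>g. f g + f' g) = m f + m f'"
proof -
  have "\<forall>f\<in>bounded_continuous T. \<forall>f'\<in>bounded_continuous T. m (\<lambda>g. f g + f' g) = m f + m f'"
    using assms(1) unfolding left_invariant_mean_def by (elim conjE)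
  from this[rule_format, OF assms(2,3)] show ?thesis .
qed

lemma mean_scale:
  assumes "left_invariant_mean G T m" "f \<in> bounded_continuous T"
  shows "m (\<lambda>g. c * f g) = c * m f"
proof -
  have "\<forall>f\<in>bounded_continuous T. \<forall>c. m (\<lambda>g. c * f g) = c * m f"
    using assms(1) unfolding left_invariant_mean_def by (elim conjE)
  from this[rule_format, OF assms(2)] show ?thesis .
qed

lemma mean_nonneg:
  assumes "left_invariant_mean G T m" "f \<in> bounded_continuous T"
    and "\<And>g. g \<in> carrier G \<Longrightarrow> 0 \<le> f g"
  shows "0 \<le> m f"
proof -
  have "\<forall>f\<in>bounded_continuous T. (\<forall>g\<in>carrier G. 0 \<le> f g) \<longrightarrow> 0 \<le> m f"
    using assms(1) unfolding left_invariant_mean_def by (elim conjE)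
  from this[rule_format, OF assms(2,3)] show ?thesis .
qed

lemma mean_one: "left_invariant_mean G T m \<Longrightarrow> m (\<lambda>_. 1) = 1"
  unfolding left_invariant_mean_def by (elim conjE)

lemma mean_translate:
  assumes "left_invariant_mean G T m" "f \<in> bounded_continuous T" "h \<in> carrier G"
  shows "m (\<lambda>g. f (h \<otimes> g)) = m f"
proof -
  have "\<forall>f\<in>bounded_continuous T. \<forall>h\<in>carrier G. m (\<lambda>g. f (h \<otimes> g)) = m f"
    using assms(1) unfolding left_invariant_mean_def by (elim conjE)
  from this[rule_format, OF assms(2,3)] show ?thesis .
qed

text \<open>If two functions agree on the group, their difference vanishes there and has nonnegative
  mean in either order. This lets \<open>action_mult\<close>, which holds only on the carrier, be
  applied under the mean.\<close>

lemma mean_cong: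
  assumes m: "left_invariant_mean G T m"
    and f: "f \<in> bounded_continuous T" and eq: "\<And>g. g \<in> carrier G \<Longrightarrow> f g = f' g"
  shows "m f = m f'"
proof -
  have le: "m p \<le> m q"
    if pq: "p \<in> bounded_continuous T" "q \<in> bounded_continuous T"
      and "\<And>g. g \<in> carrier G \<Longrightarrow> p g = q g" for p q
  proof -
    have zero: "(\<lambda>g. q g - p g) \<in> bounded_continuous T"
      by (rule bounded_continuous_cong[of "\<lambda>_. 0"])
        (auto simp: bounded_continuous_def that(3) image_constant_conv)
    then have "0 \<le> m (\<lambda>g. q g - p g)"
      by (rule mean_nonneg[OF m]) (simp add: that(3))
    moreover have "m (\<lambda>g. p g + (q g - p g)) = m p + m (\<lambda>g. q g - p g)"
      by (rule mean_add[OF m pq(1) zero])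
    ultimately show ?thesis by simp
  qed
  have "f' \<in> bounded_continuous T"
    using f eq by (rule bounded_continuous_cong)
  then show ?thesis
    using f eq by (intro antisym le) auto
qed

end

section \<open>Continuous actions on a compact space and averages along orbits\<close>

locale compact_continuous_action = topological_group G T
  for G :: "('g, 'm) monoid_scheme" (structure) and T :: "'g topology" +
  fixes \<phi> :: "'g \<Rightarrow> 'x::metric_space \<Rightarrow> 'x"
  assumes action: "continuous_action G T \<phi>"
    and compact_space: "compact (UNIV :: 'x set)"
begin

sublocale group_action G UNIV \<phi>
  using action by (simp add: continuous_action_def)

lemma action_mult: "g \<in> carrier G \<Longrightarrow> h \<in> carrier G \<Longrightarrow> \<phi> (g \<otimes> h) x = \<phi> g (\<phi> h x)"
  by (rule composition_rule[OF UNIV_I])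

lemma action_one: "\<phi> \<one> x = x"
  using fun_cong[OF id_eq_one, of x] by simp

lemma action_inv: "g \<in> carrier G \<Longrightarrow> \<phi> (inv g) (\<phi> g x) = x"
  using action_mult[of "inv g" g x] by (simp add: action_one)

lemma action_inv': "g \<in> carrier G \<Longrightarrow> \<phi> g (\<phi> (inv g) x) = x"
  using action_mult[of g "inv g" x] by (simp add: action_one)

lemma continuous_on_action:
  assumes "g \<in> carrier G"
  shows "continuous_on UNIV (\<phi> g)"
proof -
  have "continuous_map euclidean euclidean ((\<lambda>(g, x). \<phi> g x) \<circ> (\<lambda>x. (g, x)))"
    using action assms
    by (intro continuous_map_compose[where X' = "prod_topology T euclidean"])
      (simp_all add: continuous_action_def continuous_map_paired topspace_eq continuous_on_id)
  then show ?thesis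
    by (simp add: o_def)
qed

lemma orbit_function_bounded_continuous:
  assumes "continuous_on UNIV f"
  shows "(\<lambda>g. f (\<phi> g z)) \<in> bounded_continuous T"
proof -
  have "continuous_map T euclidean ((\<lambda>(g, x). \<phi> g x) \<circ> (\<lambda>g. (g, z)))"
    using action
    by (intro continuous_map_compose[where X' = "prod_topology T euclidean"])
      (simp_all add: continuous_action_def continuous_map_paired)
  then have "continuous_map T euclideanreal (f \<circ> (\<lambda>g. \<phi> g z))"
    using assms by (intro continuous_map_compose) (auto simp: o_def)
  moreover have "bounded ((\<lambda>g. f (\<phi> g z)) ` topspace T)"
    using compact_imp_bounded[OF compact_continuous_image[OF assms compact_space]]
    by (rule bounded_subset) auto
  ultimately show ?thesis
    by (simp add: bounded_continuous_def o_def)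
qed

lemma positive_functional_mean_orbit:
  assumes "left_invariant_mean G T m"
  shows "positive_functional (\<lambda>f. m (\<lambda>g. f (\<phi> g z)))"
proof
  note bc = orbit_function_bounded_continuous
  fix f g :: "'x \<Rightarrow> real" and c :: real
  assume f: "continuous_on UNIV f"
  show "m (\<lambda>h. c * f (\<phi> h z)) = c * m (\<lambda>h. f (\<phi> h z))"
    by (rule mean_scale[OF assms bc[OF f]])
  show "0 \<le> m (\<lambda>h. f (\<phi> h z))" if "\<And>x. 0 \<le> f x"
    by (rule mean_nonneg[OF assms bc[OF f]]) (rule that)
  assume g: "continuous_on UNIV g"
  show "m (\<lambda>h. f (\<phi> h z) + g (\<phi> h z)) = m (\<lambda>h. f (\<phi> h z)) + m (\<lambda>h. g (\<phi> h z))"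
    by (rule mean_add[OF assms bc[OF f] bc[OF g]])
next
  show "m (\<lambda>_. 1) = 1"
    by (rule mean_one[OF assms])
qed (rule compact_space)

lemma orbit_meets_support_neighbourhood:
  assumes "amenable G T" and erg: "uniquely_ergodic G \<phi> \<mu>"
    and x: "x \<in> measure_support \<mu>" and "0 < \<delta>"
  shows "\<exists>g\<in>carrier G. dist x (\<phi> g z) < \<delta>"
proof (rule ccontr)
  assume "\<not> ?thesis"
  then have far: "\<delta> \<le> dist x (\<phi> g z)" if "g \<in> carrier G" for g
    using that by force
  obtain m where m: "left_invariant_mean G T m"
    using assms by (auto simp: amenable_def)
  define L where "L f = m (\<lambda>g. f (\<phi> g z))" for f
  interpret positive_functional L
    unfolding L_def using m by (rule positive_functional_mean_orbit)
  \<comment> \<open>Moving the argument of \<open>f\<close> by \<open>h\<close> turns the orbit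
    function of \<open>f\<close> into its left translate by \<open>h\<close>, so left invariance of
    the mean is the side that matters.\<close>
  have L_inv: "L (\<lambda>y. f (\<phi> h y)) = L f" if "h \<in> carrier G" "continuous_on UNIV f" for h f
  proof -
    have "continuous_on UNIV (\<lambda>y. f (\<phi> h y))"
      by (rule continuous_on_compose2[OF that(2) continuous_on_action[OF that(1)]]) simp
    then have "(\<lambda>g. f (\<phi> h (\<phi> g z))) \<in> bounded_continuous T"
      by (rule orbit_function_bounded_continuous)
    moreover have "f (\<phi> h (\<phi> g z)) = f (\<phi> (h \<otimes> g) z)" if "g \<in> carrier G" for g
      using \<open>h \<in> carrier G\<close> that by (simp add: action_mult)
    ultimately have "L (\<lambda>y. f (\<phi> h y)) = m (\<lambda>g. f (\<phi> (h \<otimes> g) z))"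
      unfolding L_def by (intro mean_cong[OF m])
    also have "\<dots> = L f"
      unfolding L_def
      by (rule mean_translate[OF m orbit_function_bounded_continuous[OF that(2)] that(1)])
    finally show ?thesis .
  qed
  \<comment> \<open>A bump function, positive exactly on the open ball of radius
    \<open>\<delta>\<close> about \<open>x\<close>, which the orbit of \<open>z\<close> avoids. Its
    orbit function is zero, so the ball is null, although \<open>x\<close> lies in the
    support.\<close>
  define f where "f y = max 0 (\<delta> - dist x y)" for y
  have f_cont: "continuous_on UNIV f"
    unfolding f_def by (intro continuous_intros)
  have f_orbit: "f (\<phi> g z) = 0" if "g \<in> carrier G" for g
    using far[OF that] by (simp add: f_def)
  have "L f = L (\<lambda>_. 0)"
    unfolding L_def
    by (intro mean_cong[OF m] orbit_function_bounded_continuous f_cont f_orbit)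
  then have null: "emeasure daniell_measure {y. 0 < f y} = 0"
    by (intro daniell_measure_pos_set_eq_0 f_cont) (simp_all add: L_const, simp add: f_def)
  have "invariant_measure G \<phi> daniell_measure"
    unfolding invariant_measure_def
  proof
    fix g assume g: "g \<in> carrier G"
    then have g': "inv g \<in> carrier G" by simp
    show "distr daniell_measure daniell_measure (\<phi> g) = daniell_measure"
      by (rule distr_daniell_measure[OF continuous_on_action[OF g] L_inv[OF g]
            continuous_on_action[OF g'] L_inv[OF g'] action_inv'[OF g]])
  qed
  then have "daniell_measure = \<mu>"
    using erg borel_probability_daniell_measure unfolding uniquely_ergodic_def by blast
  moreover have "open {y. 0 < f y}"
    by (intro open_Collect_less continuous_intros f_cont)
  moreover have "x \<in> {y. 0 < f y}"
    using \<open>0 < \<delta>\<close> by (simp add: f_def)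
  ultimately have "0 < emeasure daniell_measure {y. 0 < f y}"
    using x by (auto simp: measure_support_def)
  with null show False by simp
qed

end

section \<open>Equicontinuity at an arbitrary point\<close>

theorem corollary4p1:
  fixes G :: "('g, 'm) monoid_scheme" and T :: "'g topology"
    and \<phi> :: "'g \<Rightarrow> 'x::metric_space \<Rightarrow> 'x" and \<mu> :: "'x measure"
  assumes "topological_group G T"
    and "locally_compact_space T"
    and "separable_space T"
    and "amenable G T"
    and "compact (UNIV :: 'x set)"
    and "continuous_action G T \<phi>"
    and "borel_probability \<mu>"
    and "invariant_measure G \<phi> \<mu>"
    and "uniquely_ergodic G \<phi> \<mu>"
    and "\<not> sensitive_on G \<phi> (measure_support \<mu>)"
  shows "acts_equicontinuously G \<phi>"
proof -
  interpret topological_group G T by fact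
  interpret compact_continuous_action G T \<phi>
    using assms by unfold_locales
  show ?thesis
    unfolding acts_equicontinuously_def equicontinuity_point_def
  proof (intro allI impI)
    fix z :: 'x and \<epsilon> :: real assume "0 < \<epsilon>"
    \<comment> \<open>Non-sensitivity is applied with \<open>\<beta> = \<epsilon> / 2\<close>, since
      two points will be compared through the centre \<open>x\<close>.\<close>
    then have "0 < \<epsilon> / 2" by simp
    with assms(10) obtain x \<delta> where x: "x \<in> measure_support \<mu>" and "0 < \<delta>"
      and stable: "\<And>y h. dist x y < \<delta> \<Longrightarrow> h \<in> carrier G \<Longrightarrow> dist (\<phi> h x) (\<phi> h y) < \<epsilon> / 2"
      unfolding sensitive_on_def by (meson not_le)
    obtain k where k: "k \<in> carrier G" "dist x (\<phi> k z) < \<delta>"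
      using orbit_meets_support_neighbourhood[OF assms(4,9) x \<open>0 < \<delta>\<close>] by blast
    have "open {y. dist x (\<phi> k y) < \<delta>}"
      by (intro open_Collect_less continuous_intros continuous_on_action k)
    then obtain \<eta> where "0 < \<eta>" and \<eta>: "\<And>y. dist y z < \<eta> \<Longrightarrow> dist x (\<phi> k y) < \<delta>"
      using k(2) unfolding open_dist by blast
    have "dist (\<phi> g z) (\<phi> g y) < \<epsilon>" if "dist z y < \<eta>" "g \<in> carrier G" for y g
    proof -
      \<comment> \<open>With this choice \<open>g\<close> acts as \<open>h\<close> after
        \<open>k\<close>. Both \<open>\<phi> k z\<close> and \<open>\<phi> k y\<close> lie within
        \<open>\<delta>\<close> of \<open>x\<close>, so the stability estimate at \<open>x\<close>
        applies to \<open>h\<close>, with an \<open>\<eta>\<close> that does not depend on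
        \<open>g\<close>.\<close>
      define h where "h = g \<otimes>\<^bsub>G\<^esub> inv\<^bsub>G\<^esub> k"
      have h: "h \<in> carrier G" and hk: "\<phi> g w = \<phi> h (\<phi> k w)" for w
        using that(2) k(1) by (simp_all add: h_def action_mult action_inv)
      have "dist (\<phi> h x) (\<phi> h (\<phi> k z)) < \<epsilon> / 2" "dist (\<phi> h x) (\<phi> h (\<phi> k y)) < \<epsilon> / 2"
        using k(2) \<eta>[of y] that(1)
          by (auto intro: stable[OF _ h] simp: dist_commute simp del: less_divide_eq_numeral1)
      then show ?thesis
        unfolding hk by (rule dist_triangle_half_r)
    qed
    with \<open>0 < \<eta>\<close>
    show "\<exists>\<delta>>0. \<forall>y. dist z y < \<delta> \<longrightarrow> (\<forall>g\<in>carrier G. dist (\<phi> g z) (\<phi> g y) < \<epsilon>)"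
      by blast
  qed
qed

end
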